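(* Let $H$ be an infinite-dimensional Hilbert space and let $S:H\to H$ be a bounded linear operator with $\|S\|<1$. For a bounded linear operator $T:H\to H$ with $\|T\|<1$ and $w\in H$, let $A_{T,w}$ denote the attractor of the iterated function system $(H,f_1,f_2)$, where $f_1(x)=S(x)$ and $f_2(x)=T(x)+w$ for all $x\in H$. Suppose that for every bounded linear operator $T:H\to H$ with $\|T\|<1$ there exists a sequence $(K_{T,n})_{n}$ of compact subsets of $H$ such that $A_{T,w}$ is not connected for all $w\in H\setminus\bigcup_{n}K_{T,n}$. Then the operator $S$ is compact.
   Context: A contraction on a metric space $(X,d)$ is a map $f:X\to X$ for which there is $\lambda\in(0,1)$ with $d(f(x),f(y))\le\lambda d(x,y)$ for all $x,y\in X$. An iterated function system (IFS) on a complete metric space $X$ is a finite family of contractions $f_1,\dots,f_n:X\to X$. Its attractor is the unique nonempty compact set $A\subseteq X$ with $A=f_1(A)\cup\dots\cup f_n(A)$ (it exists and is unique, being the fixed point of the contraction $C\mapsto\bigcup_{k=1}^n f_k(C)$ on the nonempty compact subsets of $X$ with the Hausdorff–Pompeiu metric). Since $\|S\|,\|T\|<1$, the maps $f_1,f_2$ in the claim are contractions. *)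

theory Defs
  imports "HOL-Analysis.Analysis"
begin

text \<open>
  Hilbert spaces over both scalar fields. A complex Hilbert space is also a real one, with the
  real part of the complex inner product as real inner product; this gives the usual norm
  \<open>sqrt (Re (cinner x x))\<close>.
\<close>

class hilbert_space = real_inner + complete_space

class chilbert_space = hilbert_space +
  fixes scaleC :: "complex \<Rightarrow> 'a \<Rightarrow> 'a"
    and cinner :: "'a \<Rightarrow> 'a \<Rightarrow> complex"
  assumes scaleC_add_right: "scaleC c (x + y) = scaleC c x + scaleC c y"
    and scaleC_add_left: "scaleC (c + d) x = scaleC c x + scaleC d x"
    and scaleC_scaleC: "scaleC c (scaleC d x) = scaleC (c * d) x"
    and scaleC_of_real: "scaleC (complex_of_real r) x = scaleR r x"
    and cinner_commute: "cinner x y = cnj (cinner y x)"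
    and cinner_add_left: "cinner (x + y) z = cinner x z + cinner y z"
    and cinner_scaleC_left: "cinner (scaleC c x) y = c * cinner x y"
    and inner_eq_Re_cinner: "inner x y = Re (cinner x y)"

definition infinite_dimensional :: "('k::field \<Rightarrow> 'a::ab_group_add \<Rightarrow> 'a) \<Rightarrow> bool" where
  "infinite_dimensional smul \<longleftrightarrow> (\<nexists>B. finite B \<and> module.span smul B = UNIV)"

definition bounded_clinear :: "('a::chilbert_space \<Rightarrow> 'b::chilbert_space) \<Rightarrow> bool" where
  "bounded_clinear f \<longleftrightarrow> bounded_linear f \<and> (\<forall>c x. f (scaleC c x) = scaleC c (f x))"

definition compact_operator :: "('a::real_normed_vector \<Rightarrow> 'b::real_normed_vector) \<Rightarrow> bool" where
  "compact_operator f \<longleftrightarrow> bounded_linear f \<and> (\<forall>B. bounded B \<longrightarrow> compact (closure (f ` B)))"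

text \<open>
  The iterated function system is given by its set of maps. The description is proper when this
  set is finite and nonempty and consists of contractions of a complete metric space.
\<close>

definition attractor :: "('a::metric_space \<Rightarrow> 'a) set \<Rightarrow> 'a set" where
  "attractor F = (THE A. A \<noteq> {} \<and> compact A \<and> A = (\<Union>f\<in>F. f ` A))"

end

theory Submission
  imports Defs
begin

text \<open>
  If \<open>S\<close> is not compact, there is an orthonormal sequence \<open>(x\<^sub>n)\<close> with \<open>\<parallel>S x\<^sub>n\<parallel>\<close> bounded below. For a
  unit vector \<open>x\<close>, one of \<open>\<parallel>x + S x\<parallel>\<^sup>2\<close> and \<open>\<parallel>x - S x\<parallel>\<^sup>2\<close> is at least \<open>1 + \<parallel>S x\<parallel>\<^sup>2\<close>, so after
  passing to a subsequence there are a sign \<open>\<sigma>\<close> and an operator \<open>T\<close> of norm less than 1 with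
  \<open>T (u + \<sigma> S u) = u\<close> for all \<open>u\<close> in the closed span \<open>M\<close> of \<open>(x\<^sub>n)\<close>. Put \<open>w = e - T e\<close>, where
  \<open>e = u\<close> if \<open>\<sigma> = -1\<close> and \<open>e - S e = u\<close> if \<open>\<sigma> = 1\<close>. Then \<open>e\<close> is the fixed point of \<open>f\<^sub>2\<close>, hence lies
  in the attractor, and \<open>f\<^sub>2 (S e) = 0 = S 0\<close> if \<open>\<sigma> = -1\<close>, \<open>f\<^sub>2 (S (S e)) = S e\<close> if \<open>\<sigma> = 1\<close>. So the
  two pieces of the attractor meet, and it is connected. Since \<open>u\<close> is recovered continuously from
  \<open>w\<close> and \<open>M\<close> is not a countable union of compact sets, these \<open>w\<close> escape any sequence of compact
  sets.
\<close>

subsection \<open>Attractors of two contractions\<close>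

text \<open>The two maps share one ratio, so that compositions of \<open>n\<close> maps contract by
  \<open>c ^ n\<close>; it is strictly positive, so that estimates can be divided by it.\<close>

locale contractive_pair =
  fixes f g :: "'a::complete_space \<Rightarrow> 'a" and c :: real
  assumes c_pos: "0 < c" and c_less_1: "c < 1"
    and contr_f: "dist (f x) (f y) \<le> c * dist x y"
    and contr_g: "dist (g x) (g y) \<le> c * dist x y"
begin

definition invariant :: "'a set \<Rightarrow> bool" where
  "invariant A \<longleftrightarrow> A \<noteq> {} \<and> compact A \<and> f ` A \<union> g ` A = A"

lemma continuous_f: "continuous_on A f" and continuous_g: "continuous_on A g"
proof -
  have "c-lipschitz_on A f" "c-lipschitz_on A g"
    using contr_f contr_g c_pos by (auto simp: lipschitz_on_def)
  then show "continuous_on A f" "continuous_on A g"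
    using lipschitz_on_continuous_on by blast+
qed

text \<open>Both maps shrink the distance to \<open>B\<close> by the factor \<open>c\<close>. On the
  compact set \<open>A\<close> this distance has a maximum, attained at \<open>a\<close>; since
  \<open>a\<close> is itself an image of a point of \<open>A\<close>, the maximum is at most
  \<open>c\<close> times itself, hence 0. Applied both ways, this is the uniqueness of the
  attractor.\<close>

lemma invariant_subset:
  assumes A: "invariant A" and B: "invariant B"
  shows "A \<subseteq> B"
proof -
  have cB: "closed B" "B \<noteq> {}" using B by (simp_all add: invariant_def compact_imp_closed)
  have "\<exists>a\<in>A. \<forall>x\<in>A. infdist x B \<le> infdist a B"
    using A by (intro continuous_attains_sup continuous_intros) (auto simp: invariant_def)
  then obtain a where a: "a \<in> A" "\<And>x. x \<in> A \<Longrightarrow> infdist x B \<le> infdist a B"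
    by blast
  have step: "infdist (h x) B \<le> c * infdist x B"
    if h: "h = f \<or> h = g" for h x
  proof -
    have "\<exists>b\<in>B. \<forall>y\<in>B. dist x b \<le> dist x y"
      using B by (intro continuous_attains_inf continuous_intros) (auto simp: invariant_def)
    then obtain b where b: "b \<in> B" "\<And>y. y \<in> B \<Longrightarrow> dist x b \<le> dist x y" by blast
    then have "dist x b \<le> infdist x B"
      unfolding infdist_notempty[OF cB(2)] by (intro cINF_greatest) auto
    have "h b \<in> B" using b h B by (auto simp: invariant_def)
    then have "infdist (h x) B \<le> dist (h x) (h b)" by (rule infdist_le)
    also have "\<dots> \<le> c * dist x b" using h contr_f contr_g by auto
    also have "\<dots> \<le> c * infdist x B" using \<open>dist x b \<le> infdist x B\<close> c_pos by simp
    finally show ?thesis .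
  qed
  have "a \<in> f ` A \<union> g ` A" using a A by (simp add: invariant_def)
  then obtain h x where "x \<in> A" "a = h x" "h = f \<or> h = g" by blast
  then have "infdist a B \<le> c * infdist a B"
    using step[of h x] a c_pos by (meson mult_left_mono order_trans less_imp_le)
  then have "infdist a B = 0"
    using c_less_1 infdist_nonneg[of a B] by (simp add: mult_le_cancel_right1 leD)
  then have "infdist x B = 0" if "x \<in> A" for x
    using a(2)[OF that] infdist_nonneg[of x B] by simp
  then show ?thesis using cB in_closed_iff_infdist_zero by blast
qed

lemma attractor_eqI: "invariant A \<Longrightarrow> attractor {f, g} = A"
proof -
  assume A: "invariant A"
  have "attractor {f, g} = (THE A. invariant A)"
    by (simp add: attractor_def invariant_def eq_commute[of _ "_ \<union> _"])
  also have "\<dots> = A"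
    by (rule the_equality) (use A invariant_subset in blast)+
  finally show ?thesis .
qed

inductive_set orbit :: "'a \<Rightarrow> 'a set" for p where
  base: "p \<in> orbit p"
| left: "x \<in> orbit p \<Longrightarrow> f x \<in> orbit p"
| right: "x \<in> orbit p \<Longrightarrow> g x \<in> orbit p"

lemma bounded_orbit: "bounded (orbit p)"
proof -
  define M where "M = max (dist p (f p)) (dist p (g p))"
  \<comment> \<open>\<open>R\<close> solves \<open>M + c * R = R\<close>, so both maps send the ball
    of radius \<open>R\<close> about \<open>p\<close> into itself.\<close>
  define R where "R = M / (1 - c)"
  have R: "M + c * R = R"
    using c_less_1 by (simp add: R_def field_simps)
  have M: "dist p (f p) \<le> M" "dist p (g p) \<le> M" "0 \<le> M" by (auto simp: M_def le_max_iff_disj)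
  have "dist p x \<le> R" if "x \<in> orbit p" for x
    using that
  proof induction
    case base
    then show ?case using M c_less_1 by (simp add: R_def)
  next
    case (left x)
    have "dist p (f x) \<le> dist p (f p) + dist (f p) (f x)" by (rule dist_triangle)
    also have "\<dots> \<le> M + c * dist p x" using M contr_f by (intro add_mono)
    also have "\<dots> \<le> M + c * R" using left c_pos by simp
    finally show ?case using R by simp
  next
    case (right x)
    have "dist p (g x) \<le> dist p (g p) + dist (g p) (g x)" by (rule dist_triangle)
    also have "\<dots> \<le> M + c * dist p x" using M contr_g by (intro add_mono)
    also have "\<dots> \<le> M + c * R" using right c_pos by simp
    finally show ?case using R by simp
  qed
  then show ?thesis by (meson bounded_def)
qed

text \<open>Every point except \<open>p\<close> is an image by construction; \<open>p\<close> is one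
  because \<open>f\<close> fixes it.\<close>

lemma orbit_unfold:
  assumes "f p = p"
  shows "orbit p = f ` orbit p \<union> g ` orbit p"
proof -
  have "x \<in> f ` orbit p \<union> g ` orbit p" if "x \<in> orbit p" for x
    using that
  proof cases
    case base
    then show ?thesis using assms orbit.base[of p] by (metis UnI1 image_eqI)
  qed auto
  then show ?thesis by (auto intro: orbit.intros)
qed

text \<open>By \<open>orbit_unfold\<close>, the images under \<open>f\<close> and \<open>g\<close>
  of a finite net of mesh \<open>r\<close> form a finite net of mesh \<open>c * r\<close>. Iteration
  starts from the single ball of radius \<open>R\<close> about \<open>p\<close>.\<close>

lemma orbit_finite_net:
  assumes "f p = p" and "e > 0"
  shows "\<exists>K. finite K \<and> orbit p \<subseteq> (\<Union>x\<in>K. cball x e)"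
proof -
  obtain R where R: "\<And>x. x \<in> orbit p \<Longrightarrow> dist p x \<le> R"
    using bounded_orbit[of p] unfolding bounded_any_center[where a=p] by blast
  have R0: "0 \<le> R" using R orbit.base[of p] by fastforce
  have net: "\<exists>K. finite K \<and> orbit p \<subseteq> (\<Union>x\<in>K. cball x (c ^ n * R))" for n
  proof (induction n)
    case 0
    show ?case using R by (intro exI[of _ "{p}"]) auto
  next
    case (Suc n)
    then obtain K where K: "finite K" "orbit p \<subseteq> (\<Union>x\<in>K. cball x (c ^ n * R))" by blast
    have "\<exists>x\<in>f ` K \<union> g ` K. dist x y \<le> c ^ Suc n * R" if y: "y \<in> orbit p" for y
    proof -
      obtain h z where h: "z \<in> orbit p" "y = h z" "h = f \<or> h = g"
        using y orbit_unfold[OF assms(1)] by blast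
      obtain x where x: "x \<in> K" "dist x z \<le> c ^ n * R" using K h by auto
      have "dist (h x) (h z) \<le> c * dist x z" using h contr_f contr_g by auto
      also have "\<dots> \<le> c * (c ^ n * R)" using x c_pos by simp
      finally have "dist (h x) y \<le> c ^ Suc n * R" using h by (simp add: mult.assoc)
      then show ?thesis using h x by blast
    qed
    then have "orbit p \<subseteq> (\<Union>x\<in>f ` K \<union> g ` K. cball x (c ^ Suc n * R))"
      unfolding subset_iff UN_iff mem_cball by blast
    then show ?case using K(1) by (intro exI[of _ "f ` K \<union> g ` K"]) simp
  qed
  have "(\<lambda>n. c ^ n * R) \<longlonglongrightarrow> 0 * R"
    using c_pos c_less_1 by (intro tendsto_intros LIMSEQ_power_zero) auto
  then have "eventually (\<lambda>n. c ^ n * R < e) sequentially"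
    using \<open>e > 0\<close> by (simp add: order_tendstoD(2))
  then obtain n where n: "c ^ n * R < e" unfolding eventually_sequentially by blast
  obtain K where K: "finite K" "orbit p \<subseteq> (\<Union>x\<in>K. cball x (c ^ n * R))" using net by blast
  note K(2)
  also have "(\<Union>x\<in>K. cball x (c ^ n * R)) \<subseteq> (\<Union>x\<in>K. cball x e)"
    using n by (intro UN_mono subset_cball) auto
  finally show ?thesis using K(1) by (intro exI[of _ K]) simp
qed

text \<open>The totally bounded orbit of a fixed point of \<open>f\<close> is invariant, and so is its closure;
  this replaces the usual fixed point argument in the Hausdorff metric.\<close>

lemma invariant_closure_orbit:
  assumes "f p = p"
  shows "invariant (closure (orbit p))"
proof -
  have comp: "compact (closure (orbit p))"
    unfolding compact_eq_totally_bounded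
  proof (intro conjI allI impI)
    show "complete (closure (orbit p))" by (simp add: complete_eq_closed)
    fix e :: real assume "e > 0"
    then obtain K where K: "finite K" "orbit p \<subseteq> (\<Union>x\<in>K. cball x (e/2))"
      using orbit_finite_net[OF assms, of "e/2"] by auto
    have "closure (orbit p) \<subseteq> (\<Union>x\<in>K. cball x (e/2))"
      using K by (intro closure_minimal closed_UN) auto
    also have "\<dots> \<subseteq> (\<Union>x\<in>K. ball x e)" using \<open>e > 0\<close> by (intro UN_mono cball_subset_ball_iff[THEN iffD2]) auto
    finally show "\<exists>k. finite k \<and> closure (orbit p) \<subseteq> (\<Union>x\<in>k. ball x e)" using K by blast
  qed
  \<comment> \<open>Compactness of the closure makes its image closed, which gives the inclusion
    that continuity alone does not.\<close>
  have im: "h ` closure (orbit p) = closure (h ` orbit p)" if "h = f \<or> h = g" for h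
  proof (rule antisym)
    have cont: "continuous_on (closure (orbit p)) h" using that continuous_f continuous_g by auto
    then show "h ` closure (orbit p) \<subseteq> closure (h ` orbit p)"
      by (intro image_closure_subset) (auto simp: closure_subset)
    have "closed (h ` closure (orbit p))"
      using cont comp compact_continuous_image compact_imp_closed by blast
    then show "closure (h ` orbit p) \<subseteq> h ` closure (orbit p)"
      by (intro closure_minimal image_mono closure_subset)
  qed
  have "f ` closure (orbit p) \<union> g ` closure (orbit p) = closure (orbit p)"
    using orbit_unfold[OF assms] im by (metis closure_Un)
  then show ?thesis
    using comp orbit.base[of p] by (auto simp: invariant_def)
qed

text \<open>If the two pieces meet, a partition of \<open>A\<close> with gap \<open>c * d\<close> would pull back to one with
  gap \<open>d\<close>; starting from the diameter of \<open>A\<close>, all gaps are excluded.\<close>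

lemma connected_invariant:
  assumes A: "invariant A" and meet: "f ` A \<inter> g ` A \<noteq> {}"
  shows "connected A"
proof -
  have Aeq: "f ` A \<union> g ` A = A" and compA: "compact A"
    using A unfolding invariant_def by argo+
  have sub: "h ` A \<subseteq> A" if "h = f \<or> h = g" for h
    using that Aeq Un_upper1[of "f ` A" "g ` A"] Un_upper2[of "g ` A" "f ` A"] by metis
  obtain D where D: "\<And>x y. x \<in> A \<Longrightarrow> y \<in> A \<Longrightarrow> dist x y \<le> D"
    using compact_imp_bounded[OF compA] by (metis bounded_two_points)
  have gap: "U = {} \<or> V = {}"
    if "A = U \<union> V" "\<And>u v. u \<in> U \<Longrightarrow> v \<in> V \<Longrightarrow> dist u v > c ^ n * D" for n U V
    using that
  proof (induction n arbitrary: U V)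
    case 0
    show ?case
    proof (rule ccontr)
      assume "\<not> ?case"
      then obtain u v where "u \<in> U" "v \<in> V" by blast
      then show False using 0(2)[of u v] D[of u v] 0(1) by auto
    qed
  next
    case (Suc n)
    \<comment> \<open>The gap bound is nonnegative because \<open>D\<close> bounds distances in
      \<open>A\<close>, so a common point would have positive distance to itself.\<close>
    have disj: "U \<inter> V = {}"
    proof -
      have "0 \<le> c ^ Suc n * D" if "x \<in> A" for x
        using D[OF that that] c_pos by simp
      moreover have "U \<inter> V \<subseteq> A" using Suc.prems(1) by blast
      ultimately show ?thesis using Suc.prems(2) by (metis Int_iff dist_self ex_in_conv in_mono not_le)
    qed
    have side: "h ` A \<subseteq> U \<or> h ` A \<subseteq> V" if h: "h = f \<or> h = g" for h
    proof -
      have "{x\<in>A. h x \<in> U} = {} \<or> {x\<in>A. h x \<in> V} = {}"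
      proof (rule Suc.IH)
        have "h ` A \<subseteq> U \<union> V" using sub[OF h] Suc.prems(1) by simp
        then show "A = {x\<in>A. h x \<in> U} \<union> {x\<in>A. h x \<in> V}" by blast
        fix u v assume uv: "u \<in> {x\<in>A. h x \<in> U}" "v \<in> {x\<in>A. h x \<in> V}"
        have "c * (c ^ n * D) < dist (h u) (h v)" using Suc.prems(2) uv by (simp add: mult.assoc)
        also have "\<dots> \<le> c * dist u v" using h contr_f contr_g by auto
        finally show "c ^ n * D < dist u v" using c_pos by simp
      qed
      moreover have "h ` A \<subseteq> U \<union> V" using sub[OF h] Suc.prems(1) by simp
      ultimately show ?thesis by blast
    qed
    \<comment> \<open>Each piece lies on one side of the partition; a common point of the pieces
      forces the same side.\<close>
    have "A \<subseteq> U \<or> A \<subseteq> V"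
    proof -
      obtain x where x: "x \<in> f ` A" "x \<in> g ` A" using meet by blast
      have "f ` A \<subseteq> U \<and> g ` A \<subseteq> U \<or> f ` A \<subseteq> V \<and> g ` A \<subseteq> V"
        using side[of f] side[of g] subsetD[OF _ x(1)] subsetD[OF _ x(2)] disj
        by (metis disjoint_iff)
      then show ?thesis using Aeq by (metis Un_least)
    qed
    moreover have "U \<subseteq> A" "V \<subseteq> A" using Suc.prems(1) by auto
    ultimately show ?case using disj by fast
  qed
  show ?thesis
  proof (rule ccontr)
    assume "\<not> connected A"
    then obtain U V where UV: "closed U" "closed V" "U \<noteq> {}" "V \<noteq> {}" "U \<union> V = A" "U \<inter> V = {}"
      unfolding connected_closed_set[OF compact_imp_closed[OF compA]] by blast
    \<comment> \<open>\<open>U\<close> is compact and \<open>V\<close> is closed, so the distance to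
      \<open>V\<close> has a positive minimum \<open>d\<close> on \<open>U\<close>. Some
      \<open>c ^ n * D\<close> lies below \<open>d\<close>, and \<open>gap\<close> applies.\<close>
    have "A \<inter> U = U" using UV(5) by blast
    then have "compact U" using compact_Int_closed[OF compA UV(1)] by simp
    then have "\<exists>a\<in>U. \<forall>u\<in>U. infdist a V \<le> infdist u V"
      using UV(3) by (intro continuous_attains_inf continuous_intros)
    then obtain a where a: "a \<in> U" "\<And>u. u \<in> U \<Longrightarrow> infdist a V \<le> infdist u V" by blast
    define d where "d = infdist a V"
    have "a \<notin> V" using a(1) UV(6) by blast
    then have "d > 0"
      using in_closed_iff_infdist_zero[OF UV(2,4)] infdist_nonneg[of a V]
      by (simp add: d_def less_le)
    moreover have "d \<le> dist u v" if "u \<in> U" "v \<in> V" for u v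
      using a(2)[OF that(1)] infdist_le[OF that(2), of u] by (simp add: d_def)
    ultimately have d: "d > 0" "\<And>u v. u \<in> U \<Longrightarrow> v \<in> V \<Longrightarrow> d \<le> dist u v" by blast+
    have "(\<lambda>n. c ^ n * D) \<longlonglongrightarrow> 0 * D"
      using c_pos c_less_1 by (intro tendsto_intros LIMSEQ_power_zero) auto
    then have "eventually (\<lambda>n. c ^ n * D < d) sequentially"
      using \<open>d > 0\<close> by (simp add: order_tendstoD(2))
    then obtain n where n: "c ^ n * D < d" unfolding eventually_sequentially by blast
    have "U = {} \<or> V = {}"
    proof (rule gap)
      show "c ^ n * D < dist u v" if "u \<in> U" "v \<in> V" for u v using n d(2)[OF that] by linarith
    qed (use UV(5) in simp)
    then show False using UV(3,4) by blast
  qed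
qed

text \<open>Banach's theorem inside the complete set \<open>A\<close> yields a fixed point of
  \<open>g\<close> there, and a contraction has only one.\<close>

lemma fixpoint_in_invariant:
  assumes A: "invariant A" and q: "g q = q"
  shows "q \<in> A"
proof -
  have "complete A" using A by (simp add: invariant_def compact_imp_complete)
  moreover have "A \<noteq> {}" "g ` A \<subseteq> A" using A by (auto simp: invariant_def)
  ultimately have "\<exists>!x. x \<in> A \<and> g x = x"
    using Banach_fix[of A c g] c_pos c_less_1 contr_g by simp
  then obtain x where x: "x \<in> A" "g x = x" by blast
  have "dist x q \<le> c * dist x q" using contr_g[of x q] x q by simp
  then have "dist x q = 0"
    using c_less_1 zero_le_dist[of x q] by (simp add: mult_le_cancel_right1 leD)
  then show ?thesis using x by simp
qed

end

text \<open>\<open>R\<close> is the inverse of \<open>id - T\<close>, Lipschitz with constant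
  \<open>1 / (1 - onorm T)\<close>. Its continuity turns compact sets of translations
  \<open>w\<close> into compact sets of fixed points.\<close>

lemma bounded_linear_contraction_fixpoint:
  fixes T :: "'a::banach \<Rightarrow> 'a"
  assumes T: "bounded_linear T" "onorm T < 1"
  obtains R where "continuous_on UNIV R" "\<And>w. R w = T (R w) + w" "\<And>w e. e = T e + w \<Longrightarrow> e = R w"
proof -
  interpret T: bounded_linear T by fact
  have nT: "norm (T x - T y) \<le> onorm T * norm (x - y)" for x y
    using onorm[OF T(1), of "x - y"] by (simp add: T.diff)
  have ex: "\<exists>!x. T x + w = x" for w
    by (rule banach_fix_type[of "onorm T"]) (use T nT onorm_pos_le in \<open>auto simp: dist_norm\<close>)
  define R where "R w = (THE x. T x + w = x)" for w
  have R: "T (R w) + w = R w" for w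
    unfolding R_def by (rule theI') (rule ex)
  have "(1 / (1 - onorm T))-lipschitz_on UNIV R"
  proof (rule lipschitz_onI)
    fix v w
    have "norm (R v - R w) = norm (T (R v) - T (R w) + (v - w))"
      using R[of v] R[of w] by (metis add_diff_add)
    also have "\<dots> \<le> onorm T * norm (R v - R w) + norm (v - w)"
      using norm_triangle_ineq nT by (meson add_right_mono order_trans)
    finally show "dist (R v) (R w) \<le> 1 / (1 - onorm T) * dist v w"
      using T(2) by (simp add: dist_norm field_simps)
  qed (use T in auto)
  then have "continuous_on UNIV R" by (rule lipschitz_on_continuous_on)
  moreover have "e = R w" if "e = T e + w" for e w using that ex[of w] R[of w] by metis
  ultimately show ?thesis using that R by metis
qed

subsection \<open>Noncompact operators\<close>

instance hilbert_space \<subseteq> banach ..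

text \<open>The common kernel of \<open>\<Phi>\<close> has finite codimension, so a bounded set is
  totally bounded modulo this kernel. Instead of a quotient space, the induction adds one functional
  at a time and corrects its value along a vector \<open>d\<close> of the previous kernel.\<close>

lemma finite_codim_net:
  fixes B :: "'a::real_normed_vector set" and \<Phi> :: "('a \<Rightarrow> real) set"
  assumes "finite \<Phi>" "\<And>\<phi>. \<phi> \<in> \<Phi> \<Longrightarrow> bounded_linear \<phi>" "bounded B" "0 < \<eta>"
  shows "\<exists>F. finite F \<and> (\<forall>x\<in>B. \<exists>b\<in>F. \<exists>z. norm z \<le> \<eta> \<and> (\<forall>\<phi>\<in>\<Phi>. \<phi> (x - b - z) = 0))"
  using assms(1,2,4)
proof (induction \<Phi> arbitrary: \<eta> rule: finite_induct)
  case empty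
  then show ?case by (intro exI[of _ "{0}"]) (auto intro: exI[of _ 0])
next
  case (insert \<psi> \<Phi>)
  interpret psi: bounded_linear \<psi> using insert.prems by simp
  obtain F where F: "finite F"
    "\<And>x. x \<in> B \<Longrightarrow> \<exists>b\<in>F. \<exists>z. norm z \<le> \<eta>/2 \<and> (\<forall>\<phi>\<in>\<Phi>. \<phi> (x - b - z) = 0)"
    using insert.IH[of "\<eta>/2"] insert.prems by auto
  show ?case
  proof (cases "\<exists>d. (\<forall>\<phi>\<in>\<Phi>. \<phi> d = 0) \<and> \<psi> d \<noteq> 0")
    \<comment> \<open>Here \<open>\<psi>\<close> vanishes on the common kernel of
      \<open>\<Phi>\<close>, so the old net serves.\<close>
    case False
    have "\<exists>b\<in>F. \<exists>z. norm z \<le> \<eta> \<and> (\<forall>\<phi>\<in>insert \<psi> \<Phi>. \<phi> (x - b - z) = 0)" if x: "x \<in> B" for x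
    proof -
      obtain b z where "b \<in> F" "norm z \<le> \<eta>/2" "\<forall>\<phi>\<in>\<Phi>. \<phi> (x - b - z) = 0"
        using F(2)[OF x] by blast
      then show ?thesis using False insert.prems(2) by (intro bexI[of _ b] exI[of _ z]) auto
    qed
    then show ?thesis using F(1) by blast
  next
    case True
    then obtain d' where d': "\<forall>\<phi>\<in>\<Phi>. \<phi> d' = 0" "\<psi> d' \<noteq> 0" by blast
    define d where "d = d' /\<^sub>R \<psi> d'"
    have lin: "linear \<phi>" if "\<phi> \<in> \<Phi>" for \<phi>
      using insert.prems(1) that bounded_linear.linear by blast
    have d: "\<phi> d = 0" if "\<phi> \<in> \<Phi>" for \<phi>
      using d' that lin[OF that] by (simp add: d_def linear_scale)
    have psi_d: "\<psi> d = 1" using d' by (simp add: d_def psi.scaleR)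
    have d0: "norm d > 0" using psi_d psi.zero by auto
    obtain r where r: "\<And>x. x \<in> B \<Longrightarrow> norm x \<le> r" using assms(3) by (auto simp: bounded_iff)
    obtain K where K: "0 \<le> K" "\<And>x. norm (\<psi> x) \<le> norm x * K" using psi.nonneg_bounded by blast
    obtain r' where r': "\<And>b. b \<in> F \<Longrightarrow> norm b \<le> r'"
      using finite_imp_bounded[OF F(1)] by (auto simp: bounded_iff)
    \<comment> \<open>\<open>M\<close> bounds the value \<open>s\<close> of \<open>\<psi>\<close> on
      every remainder \<open>x - b - z\<close>. Rounding \<open>s\<close> to a point of a finite net
      of \<open>{-M..M}\<close> with this mesh moves the vector by at most \<open>\<eta>/2\<close>,
      the half saved in the induction hypothesis.\<close>
    define M where "M = (r + r' + \<eta>/2) * K"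
    have "\<exists>G. finite G \<and> {-M..M} \<subseteq> (\<Union>t\<in>G. ball t (\<eta> / (2 * norm d)))"
      using compact_Icc[of "-M" M] d0 insert.prems(2) unfolding compact_eq_totally_bounded
      by (metis divide_pos_pos mult_pos_pos zero_less_numeral)
    then obtain G where G: "finite G" "{-M..M} \<subseteq> (\<Union>t\<in>G. ball t (\<eta> / (2 * norm d)))" by blast
    define F' where "F' = (\<lambda>(b, t). b + t *\<^sub>R d) ` (F \<times> G)"
    have "\<exists>b\<in>F'. \<exists>z. norm z \<le> \<eta> \<and> (\<forall>\<phi>\<in>insert \<psi> \<Phi>. \<phi> (x - b - z) = 0)" if x: "x \<in> B" for x
    proof -
      obtain b z where bz: "b \<in> F" "norm z \<le> \<eta>/2" "\<forall>\<phi>\<in>\<Phi>. \<phi> (x - b - z) = 0"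
        using F(2)[OF x] by blast
      define s where "s = \<psi> (x - b - z)"
      have "norm (x - b - z) \<le> r + r' + \<eta>/2"
        using r[OF x] r'[OF bz(1)] bz(2) norm_triangle_ineq4[of "x - b" z] norm_triangle_ineq4[of x b]
        by linarith
      then have "\<bar>s\<bar> \<le> M" using K(2)[of "x - b - z"] mult_right_mono[OF _ K(1)]
        unfolding M_def s_def by (metis order_trans real_norm_def)
      then have "s \<in> {-M..M}" by auto
      then obtain t where t: "t \<in> G" "\<bar>s - t\<bar> < \<eta> / (2 * norm d)"
        using G(2) by (auto simp: dist_real_def abs_minus_commute)
      define z' where "z' = z + (s - t) *\<^sub>R d"
      have eq: "x - (b + t *\<^sub>R d) - z' = (x - b - z) - s *\<^sub>R d"
        by (simp add: z'_def algebra_simps)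
      have "norm z' \<le> norm z + \<bar>s - t\<bar> * norm d"
        unfolding z'_def by (metis norm_scaleR norm_triangle_ineq)
      also have "\<bar>s - t\<bar> * norm d \<le> \<eta>/2" using t(2) d0 by (simp add: field_simps)
      finally have "norm z' \<le> \<eta>" using bz(2) by simp
      moreover have "\<phi> (x - (b + t *\<^sub>R d) - z') = 0" if "\<phi> \<in> \<Phi>" for \<phi>
        unfolding eq linear_diff[OF lin[OF that], of "x - b - z"]
        using bspec[OF bz(3) that] d[OF that] by (simp add: linear_scale[OF lin[OF that]])
      moreover have "\<psi> (x - (b + t *\<^sub>R d) - z') = 0"
        unfolding eq psi.diff[of "x - b - z"] by (simp add: psi.scaleR psi_d s_def)
      moreover have "b + t *\<^sub>R d \<in> F'" using bz(1) t(1) by (auto simp: F'_def)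
      ultimately show ?thesis by blast
    qed
    then show ?thesis using F(1) G(1) by (intro exI[of _ F']) (simp add: F'_def)
  qed
qed

lemma noncompact_operator_kernel_bound:
  fixes S :: "'a::real_normed_vector \<Rightarrow> 'b::banach"
  assumes S: "bounded_linear S" and nc: "\<not> compact_operator S"
  obtains \<delta> where "\<delta> > 0"
    "\<And>\<Phi> :: ('a \<Rightarrow> real) set. finite \<Phi> \<Longrightarrow> (\<And>\<phi>. \<phi> \<in> \<Phi> \<Longrightarrow> bounded_linear \<phi>) \<Longrightarrow>
      \<exists>x. (\<forall>\<phi>\<in>\<Phi>. \<phi> x = 0) \<and> norm x = 1 \<and> norm (S x) \<ge> \<delta>"
proof -
  interpret S: bounded_linear S by fact
  obtain B where B: "bounded B" "\<not> compact (closure (S ` B))"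
    using S nc unfolding compact_operator_def by blast
  have "complete (closure (S ` B))" by (simp add: complete_eq_closed)
  then obtain e where e: "e > 0" "\<And>k. finite k \<Longrightarrow> \<not> closure (S ` B) \<subseteq> (\<Union>x\<in>k. ball x e)"
    using B(2) unfolding compact_eq_totally_bounded by blast
  have net: "\<not> S ` B \<subseteq> (\<Union>x\<in>k. cball x (e/2))" if "finite k" for k
  proof
    assume "S ` B \<subseteq> (\<Union>x\<in>k. cball x (e/2))"
    then have "closure (S ` B) \<subseteq> (\<Union>x\<in>k. cball x (e/2))"
      using that by (intro closure_minimal closed_UN) auto
    also have "\<dots> \<subseteq> (\<Union>x\<in>k. ball x e)" 
      using \<open>e > 0\<close> by (intro UN_mono cball_subset_ball_iff[THEN iffD2]) auto
    finally show False using e(2)[OF that] by blast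
  qed
  obtain r where r: "r > 0" "\<And>x. x \<in> B \<Longrightarrow> norm x \<le> r" using B(1) by (metis bounded_pos)
  obtain K where K: "K > 0" "\<And>x. norm (S x) \<le> norm x * K" using S.pos_bounded by blast
  \<comment> \<open>The two errors are each kept to \<open>e/4\<close>:
    \<open>2 * \<eta> * K\<close> bounds the image of \<open>z - z'\<close>, and
    \<open>\<delta> * (2 * r + 2)\<close> the image of the kernel vector \<open>u\<close>
    below.\<close>
  define \<eta> where "\<eta> = min 1 (e / (8 * K))"
  have \<eta>: "0 < \<eta>" "\<eta> \<le> 1" "2 * \<eta> * K \<le> e / 4"
    using e K by (auto simp: \<eta>_def min_def field_simps)
  define \<delta> where "\<delta> = e / (4 * (2 * r + 2))"
  have \<delta>: "\<delta> > 0" using e r by (simp add: \<delta>_def)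
  have "\<exists>x. (\<forall>\<phi>\<in>\<Phi>. \<phi> x = 0) \<and> norm x = 1 \<and> norm (S x) \<ge> \<delta>"
    if \<Phi>: "finite \<Phi>" "\<And>\<phi>. \<phi> \<in> \<Phi> \<Longrightarrow> bounded_linear \<phi>" for \<Phi> :: "('a \<Rightarrow> real) set"
  proof (rule ccontr)
    assume neg: "\<not> ?thesis"
    have small: "norm (S x) \<le> \<delta> * norm x" if x: "\<And>\<phi>. \<phi> \<in> \<Phi> \<Longrightarrow> \<phi> x = 0" for x
    proof (cases "x = 0")
      case False
      have "\<phi> (sgn x) = 0" if "\<phi> \<in> \<Phi>" for \<phi>
        using x[OF that] linear_scale[OF bounded_linear.linear[OF \<Phi>(2)[OF that]]]
        by (simp add: sgn_div_norm)
      then have "norm (S (sgn x)) < \<delta>" using neg False norm_sgn[of x] by (meson not_le)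
      then show ?thesis using False by (simp add: sgn_div_norm S.scaleR field_simps)
    qed (simp add: S.zero)
    obtain F where F: "finite F"
      "\<And>x. x \<in> B \<Longrightarrow> \<exists>b\<in>F. \<exists>z. norm z \<le> \<eta> \<and> (\<forall>\<phi>\<in>\<Phi>. \<phi> (x - b - z) = 0)"
      using finite_codim_net[OF \<Phi> B(1) \<eta>(1)] by blast
    define near where "near x b \<longleftrightarrow> (\<exists>z. norm z \<le> \<eta> \<and> (\<forall>\<phi>\<in>\<Phi>. \<phi> (x - b - z) = 0))" for x b
    \<comment> \<open>A centre \<open>b\<close> may be far from \<open>B\<close>, at a distance
      depending on \<open>\<Phi>\<close>. Replacing it by a point of \<open>B\<close> near it keeps
      \<open>norm u \<le> 2 * r + 2\<close>. Where no such point exists, the choice is arbitrary and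
      only adds a ball to the cover.\<close>
    define rep where "rep b = (SOME y. y \<in> B \<and> near y b)" for b
    have "S ` B \<subseteq> (\<Union>y\<in>(\<lambda>b. S (rep b)) ` F. cball y (e/2))"
    proof clarify
      fix x assume x: "x \<in> B"
      then obtain b where b: "b \<in> F" "near x b" unfolding near_def using F(2)[OF x] by blast
      then have y: "rep b \<in> B" "near (rep b) b"
        unfolding rep_def using someI[of "\<lambda>y. y \<in> B \<and> near y b" x] x by auto
      obtain z z' where z: "norm z \<le> \<eta>" "\<And>\<phi>. \<phi> \<in> \<Phi> \<Longrightarrow> \<phi> (x - b - z) = 0"
        and z': "norm z' \<le> \<eta>" "\<And>\<phi>. \<phi> \<in> \<Phi> \<Longrightarrow> \<phi> (rep b - b - z') = 0"
        using b y by (auto simp: near_def)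
      define u where "u = (x - b - z) - (rep b - b - z')"
      have nz: "norm (z - z') \<le> 2 * \<eta>" using z(1) z'(1) norm_triangle_ineq4[of z z'] by linarith
      have xu: "x - rep b = u + (z - z')" by (simp add: u_def)
      have "\<phi> u = 0" if "\<phi> \<in> \<Phi>" for \<phi>
        unfolding u_def using z(2)[OF that] z'(2)[OF that] \<Phi>(2)[OF that]
        by (metis bounded_linear.linear diff_self linear_diff)
      then have "norm (S u) \<le> \<delta> * norm u" by (rule small)
      also have "norm u \<le> 2 * r + 2"
      proof -
        have "u = x - rep b - (z - z')" by (simp add: u_def)
        then have "norm u \<le> norm x + norm (rep b) + norm (z - z')"
          using norm_triangle_ineq4[of "x - rep b" "z - z'"] norm_triangle_ineq4[of x "rep b"] by simp
        then show ?thesis using r(2)[OF x] r(2)[OF y(1)] nz \<eta>(2) by linarith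
      qed
      also have "\<delta> * (2 * r + 2) = e/4" using r(1) by (simp add: \<delta>_def field_simps)
      finally have Su: "norm (S u) \<le> e/4" using \<delta> by simp
      have "norm (S (z - z')) \<le> norm (z - z') * K" by (rule K(2))
      also have "\<dots> \<le> 2 * \<eta> * K" using nz K(1) by (simp add: mult_right_mono)
      finally have "norm (S (z - z')) \<le> e/4" using \<eta>(3) by simp
      then have "norm (S (x - rep b)) \<le> e/2"
        unfolding xu S.add[of u] using Su norm_triangle_ineq[of "S u" "S (z - z')"] by linarith
      then have "S x \<in> cball (S (rep b)) (e/2)"
        by (simp add: dist_norm S.diff norm_minus_commute)
      then show "S x \<in> (\<Union>y\<in>(\<lambda>b. S (rep b)) ` F. cball y (e/2))" using b(1) by blast
    qed
    then show False using net[of "(\<lambda>b. S (rep b)) ` F"] F(1) by blast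
  qed
  then show ?thesis using that \<delta> by blast
qed

text \<open>The sign \<open>\<sigma>\<close> is only chosen after the whole sequence, so the images under \<open>1 + S\<close> and under
  \<open>1 - S\<close> are made orthogonal. With \<open>G = {id}\<close> this is the real setting, with
  \<open>G = {id, \<i>}\<close> the complex one.\<close>

lemma noncompact_operator_orthogonal_sequence:
  fixes S :: "'a::hilbert_space \<Rightarrow> 'a"
  assumes S: "bounded_linear S" and nc: "\<not> compact_operator S" and G: "finite G"
  obtains f :: "nat \<Rightarrow> 'a" and \<delta> \<sigma> :: real where "\<delta> > 0" "\<sigma> = 1 \<or> \<sigma> = -1" "\<And>n. norm (f n) = 1"
    "\<And>n. norm (f n + \<sigma> *\<^sub>R S (f n)) ^ 2 \<ge> 1 + \<delta>"
    "\<And>k n g. k < n \<Longrightarrow> g \<in> G \<Longrightarrow> f n \<bullet> g (f k) = 0"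
    "\<And>k n g. k < n \<Longrightarrow> g \<in> G \<Longrightarrow> (f n + \<sigma> *\<^sub>R S (f n)) \<bullet> g (f k + \<sigma> *\<^sub>R S (f k)) = 0"
proof -
  interpret S: bounded_linear S by fact
  obtain \<delta> where \<delta>: "\<delta> > 0"
    "\<And>\<Phi> :: ('a \<Rightarrow> real) set. finite \<Phi> \<Longrightarrow> (\<And>\<phi>. \<phi> \<in> \<Phi> \<Longrightarrow> bounded_linear \<phi>) \<Longrightarrow>
      \<exists>x. (\<forall>\<phi>\<in>\<Phi>. \<phi> x = 0) \<and> norm x = 1 \<and> norm (S x) \<ge> \<delta>"
    using noncompact_operator_kernel_bound[OF S nc] by blast
  \<comment> \<open>The value 0 of \<open>\<sigma>\<close> makes the vectors themselves orthogonal,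
    the values 1 and -1 their images under both candidate operators.\<close>
  define ok where "ok f n x \<longleftrightarrow> norm x = 1 \<and> norm (S x) \<ge> \<delta> \<and>
    (\<forall>k<n. \<forall>g\<in>G. \<forall>\<sigma>\<in>{0, 1, -1}. (x + \<sigma> *\<^sub>R S x) \<bullet> g (f k + \<sigma> *\<^sub>R S (f k)) = 0)"
    for f :: "nat \<Rightarrow> 'a" and n x
  have "\<exists>f. \<forall>n. ok f n (f n)"
  proof (rule dependent_wellorder_choice)
    show "ok f n x = ok f' n x" if "\<And>k. k < n \<Longrightarrow> f k = f' k" for f f' n x
      using that by (simp add: ok_def)
    fix n and f :: "nat \<Rightarrow> 'a"
    \<comment> \<open>With the earlier vectors fixed, the orthogonality conditions on the next one
      say that finitely many bounded functionals vanish.\<close>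
    define \<Phi> where "\<Phi> = (\<lambda>(k, g, \<sigma>). \<lambda>x. (x + \<sigma> *\<^sub>R S x) \<bullet> g (f k + \<sigma> *\<^sub>R S (f k)))
      ` ({..<n} \<times> G \<times> {0, 1, -1})"
    have "finite \<Phi>" using G by (simp add: \<Phi>_def)
    moreover have "bounded_linear \<phi>" if "\<phi> \<in> \<Phi>" for \<phi>
      using that S unfolding \<Phi>_def
      by (auto intro!: bounded_linear_inner_left_comp bounded_linear_add bounded_linear_ident
          bounded_linear_const_scaleR bounded_linear_sub bounded_linear_minus)
    ultimately obtain x where "\<forall>\<phi>\<in>\<Phi>. \<phi> x = 0" "norm x = 1" "norm (S x) \<ge> \<delta>"
      using \<delta>(2) by blast
    then show "\<exists>x. ok f n x" by (intro exI[of _ x]) (force simp: ok_def \<Phi>_def)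
  qed
  then obtain f where f: "\<And>n. ok f n (f n)" by blast
  \<comment> \<open>Each \<open>n\<close> admits a sign that makes the cross term in the square of
    the norm nonnegative, so one sign works infinitely often.\<close>
  have "\<exists>\<sigma>\<in>{1, -1}. infinite {n. \<sigma> * (S (f n) \<bullet> f n) \<ge> 0}"
  proof (rule ccontr)
    assume "\<not> ?thesis"
    then have "finite ({n. S (f n) \<bullet> f n \<ge> 0} \<union> {n. - (S (f n) \<bullet> f n) \<ge> 0})" by simp
    moreover have "{n. S (f n) \<bullet> f n \<ge> 0} \<union> {n. - (S (f n) \<bullet> f n) \<ge> 0} = UNIV" by auto
    ultimately show False by (metis infinite_UNIV_nat)
  qed
  then obtain \<sigma> where \<sigma>: "\<sigma> = 1 \<or> \<sigma> = -1" "infinite {n. \<sigma> * (S (f n) \<bullet> f n) \<ge> 0}" by blast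
  obtain s :: "nat \<Rightarrow> nat" where s: "strict_mono s" "\<And>n. \<sigma> * (S (f (s n)) \<bullet> f (s n)) \<ge> 0"
    using infinite_enumerate[OF \<sigma>(2)] by blast
  show ?thesis
  proof (rule that[of "\<delta>\<^sup>2" \<sigma> "f \<circ> s"])
    show "\<delta>\<^sup>2 > 0" using \<delta> by simp
    show "\<sigma> = 1 \<or> \<sigma> = -1" by fact
    show "norm ((f \<circ> s) n) = 1" for n using f[of "s n"] by (simp add: ok_def)
    show "norm ((f \<circ> s) n + \<sigma> *\<^sub>R S ((f \<circ> s) n)) ^ 2 \<ge> 1 + \<delta>\<^sup>2" for n
    proof -
      define x where "x = f (s n)"
      have x: "norm x = 1" "norm (S x) \<ge> \<delta>" using f[of "s n"] by (simp_all add: ok_def x_def)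
      have "norm (x + \<sigma> *\<^sub>R S x) ^ 2 = norm x ^ 2 + 2 * (\<sigma> * (S x \<bullet> x)) + \<sigma>\<^sup>2 * norm (S x) ^ 2"
        unfolding power2_norm_eq_inner
        by (simp add: inner_add inner_commute power2_eq_square algebra_simps)
      moreover have "\<sigma>\<^sup>2 = 1" using \<sigma>(1) by auto
      moreover have "norm (S x) ^ 2 \<ge> \<delta>\<^sup>2" using x(2) \<delta>(1) by (simp add: power_mono)
      ultimately show ?thesis using x(1) s(2)[of n] by (simp add: x_def)
    qed
    fix k n :: nat and g assume "k < n" "g \<in> G"
    then have *: "(f (s n) + \<tau> *\<^sub>R S (f (s n))) \<bullet> g (f (s k) + \<tau> *\<^sub>R S (f (s k))) = 0"
      if "\<tau> \<in> {0, 1, -1}" for \<tau>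
      using f[of "s n"] s(1) that unfolding ok_def strict_mono_def by blast
    show "(f \<circ> s) n \<bullet> g ((f \<circ> s) k) = 0" using *[of 0] by simp
    show "((f \<circ> s) n + \<sigma> *\<^sub>R S ((f \<circ> s) n)) \<bullet> g ((f \<circ> s) k + \<sigma> *\<^sub>R S ((f \<circ> s) k)) = 0"
      using *[of \<sigma>] \<sigma>(1) by simp
  qed
qed

subsection \<open>Orthogonal systems\<close>

text \<open>\<open>y\<close> is the orthogonal projection of \<open>x\<close> to the span, and the
  sum equals both \<open>x \<bullet> y\<close> and \<open>(norm y)\<^sup>2\<close>; expand
  \<open>(norm (x - y))\<^sup>2\<close>. A vanishing \<open>v i\<close> contributes 0, as division
  by 0 gives 0.\<close>

lemma bessel_orthogonal:
  fixes v :: "'i \<Rightarrow> 'a::real_inner"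
  assumes I: "finite I" and orth: "\<And>i j. i \<in> I \<Longrightarrow> j \<in> I \<Longrightarrow> i \<noteq> j \<Longrightarrow> v i \<bullet> v j = 0"
  shows "(\<Sum>i\<in>I. (x \<bullet> v i)\<^sup>2 / (norm (v i))\<^sup>2) \<le> (norm x)\<^sup>2"
proof -
  define a where "a i = (x \<bullet> v i) / (norm (v i))\<^sup>2" for i
  define y where "y = (\<Sum>i\<in>I. a i *\<^sub>R v i)"
  have coeff: "a i * (x \<bullet> v i) = (x \<bullet> v i)\<^sup>2 / (norm (v i))\<^sup>2" for i
    by (simp add: a_def power2_eq_square)
  have "x \<bullet> y = (\<Sum>i\<in>I. (x \<bullet> v i)\<^sup>2 / (norm (v i))\<^sup>2)"
    by (simp add: y_def inner_sum_right coeff)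
  moreover have "(norm y)\<^sup>2 = (\<Sum>i\<in>I. (x \<bullet> v i)\<^sup>2 / (norm (v i))\<^sup>2)"
  proof -
    have "(norm y)\<^sup>2 = (\<Sum>i\<in>I. (norm (a i *\<^sub>R v i))\<^sup>2)"
      unfolding y_def using I orth
      by (intro norm_sum_Pythagorean) (auto simp: pairwise_def orthogonal_def)
    also have "\<dots> = (\<Sum>i\<in>I. (x \<bullet> v i)\<^sup>2 / (norm (v i))\<^sup>2)"
      by (intro sum.cong) (auto simp: a_def power_mult_distrib power_divide power2_eq_square)
    finally show ?thesis .
  qed
  moreover have "0 \<le> (norm (x - y))\<^sup>2" by simp
  moreover have "(norm (x - y))\<^sup>2 = (norm x)\<^sup>2 - 2 * (x \<bullet> y) + (norm y)\<^sup>2"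
    by (simp add: power2_norm_eq_inner inner_diff inner_commute)
  ultimately show ?thesis by linarith
qed

text \<open>The Riesz-Fischer argument: by Pythagoras, blocks of the series have the norms of blocks
  of the square sum, so the Cauchy criterion carries over, and completeness gives the limit.\<close>

lemma orthonormal_series_summable:
  fixes e :: "nat \<Rightarrow> 'a::hilbert_space"
  assumes e: "\<And>m n. e m \<bullet> e n = (if m = n then 1 else 0)"
    and bound: "\<And>I. finite I \<Longrightarrow> (\<Sum>n\<in>I. (a n)\<^sup>2) \<le> M\<^sup>2" and "0 \<le> M"
  shows "summable (\<lambda>n. a n *\<^sub>R e n)" "norm (\<Sum>n. a n *\<^sub>R e n) \<le> M"
proof -
  have sq: "(norm (\<Sum>n\<in>I. a n *\<^sub>R e n))\<^sup>2 = (\<Sum>n\<in>I. (a n)\<^sup>2)" if "finite I" for I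
  proof -
    have "(norm (\<Sum>n\<in>I. a n *\<^sub>R e n))\<^sup>2 = (\<Sum>n\<in>I. (norm (a n *\<^sub>R e n))\<^sup>2)"
      using that e by (intro norm_sum_Pythagorean) (auto simp: pairwise_def orthogonal_def)
    also have "\<dots> = (\<Sum>n\<in>I. (a n)\<^sup>2)"
      using e by (simp add: norm_eq_sqrt_inner)
    finally show ?thesis .
  qed
  have "summable (\<lambda>n. (a n)\<^sup>2)"
    using bound by (intro bounded_imp_summable[of _ "M\<^sup>2"]) auto
  then have cauchy: "\<forall>\<epsilon>>0. \<exists>N. \<forall>m\<ge>N. \<forall>n. norm (\<Sum>k=m..<n. (a k)\<^sup>2) < \<epsilon>"
    by (simp add: summable_Cauchy)
  show sum: "summable (\<lambda>n. a n *\<^sub>R e n)"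
    unfolding summable_Cauchy
  proof (intro allI impI)
    fix \<epsilon> :: real assume "\<epsilon> > 0"
    then obtain N where N: "\<And>m n. m \<ge> N \<Longrightarrow> norm (\<Sum>k=m..<n. (a k)\<^sup>2) < \<epsilon>\<^sup>2"
      using cauchy by (meson zero_less_power)
    have "norm (\<Sum>k=m..<n. a k *\<^sub>R e k) < \<epsilon>" if "m \<ge> N" for m n
    proof (rule power2_less_imp_less)
      show "(norm (\<Sum>k=m..<n. a k *\<^sub>R e k))\<^sup>2 < \<epsilon>\<^sup>2"
        unfolding sq[OF finite_atLeastLessThan] using N[OF that, of n] by simp
    qed (use \<open>\<epsilon> > 0\<close> in simp)
    then show "\<exists>N. \<forall>m\<ge>N. \<forall>n. norm (\<Sum>k=m..<n. a k *\<^sub>R e k) < \<epsilon>" by blast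
  qed
  have "norm (\<Sum>k<n. a k *\<^sub>R e k) \<le> M" for n
    by (rule power2_le_imp_le) (use bound \<open>0 \<le> M\<close> in \<open>simp_all only: sq finite_lessThan\<close>)
  then show "norm (\<Sum>n. a n *\<^sub>R e n) \<le> M"
    using LIMSEQ_le_const2[OF tendsto_norm[OF summable_LIMSEQ[OF sum]]] by blast
qed

text \<open>The operator sends \<open>x\<close> to the series of its coefficients along
  \<open>v\<close>, rebuilt along \<open>e\<close>. It is used with \<open>c > 1\<close>, where it
  is a contraction.\<close>

lemma orthogonal_system_operator:
  fixes e v :: "nat \<Rightarrow> 'a::hilbert_space"
  assumes e: "\<And>m n. e m \<bullet> e n = (if m = n then 1 else 0)"
    and v: "\<And>m n. m \<noteq> n \<Longrightarrow> v m \<bullet> v n = 0" "\<And>n. norm (v n) \<ge> c" and c: "c > 0"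
  shows "\<exists>T. bounded_linear T \<and> onorm T \<le> 1 / c \<and> (\<forall>n. T (v n) = e n)"
proof -
  define a where "a x n = (x \<bullet> v n) / (norm (v n))\<^sup>2" for x n
  have v_pos: "norm (v n) > 0" for n using v(2)[of n] c by linarith
  have bound: "(\<Sum>n\<in>I. (a x n)\<^sup>2) \<le> (norm x / c)\<^sup>2" if I: "finite I" for x I
  proof -
    \<comment> \<open>Of the two factors \<open>1 / (norm (v n))\<^sup>2\<close> in the square, one
      is spent on Bessel's inequality and the other is bounded by
      \<open>1 / c\<^sup>2\<close>.\<close>
    have "(a x n)\<^sup>2 \<le> ((x \<bullet> v n)\<^sup>2 / (norm (v n))\<^sup>2) / c\<^sup>2" for n
    proof -
      have "c\<^sup>2 \<le> (norm (v n))\<^sup>2" using v(2) c by (simp add: power_mono)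
      then have "((x \<bullet> v n)\<^sup>2 / (norm (v n))\<^sup>2) / (norm (v n))\<^sup>2 \<le> ((x \<bullet> v n)\<^sup>2 / (norm (v n))\<^sup>2) / c\<^sup>2"
        using c v_pos[of n] by (intro divide_left_mono) auto
      then show ?thesis by (simp add: a_def power_divide power2_eq_square)
    qed
    then have "(\<Sum>n\<in>I. (a x n)\<^sup>2) \<le> (\<Sum>n\<in>I. (x \<bullet> v n)\<^sup>2 / (norm (v n))\<^sup>2) / c\<^sup>2"
      unfolding sum_divide_distrib by (intro sum_mono)
    also have "\<dots> \<le> (norm x)\<^sup>2 / c\<^sup>2"
      using bessel_orthogonal[OF I, of v x] v(1) by (intro divide_right_mono) auto
    finally show ?thesis by (simp add: power_divide)
  qed
  define T where "T x = (\<Sum>n. a x n *\<^sub>R e n)" for x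
  have sum: "summable (\<lambda>n. a x n *\<^sub>R e n)" and norm_T: "norm (T x) \<le> norm x * (1 / c)" for x
    using orthonormal_series_summable[OF e bound, of x] c by (simp_all add: T_def)
  have "bounded_linear T"
  proof (rule bounded_linear_intro[OF _ _ norm_T])
    show "T (x + y) = T x + T y" for x y
      unfolding T_def suminf_add[OF sum sum]
      by (simp add: a_def inner_add_left add_divide_distrib scaleR_add_left)
    show "T (r *\<^sub>R x) = r *\<^sub>R T x" for r x
      unfolding T_def suminf_scaleR_right[OF sum] by (simp add: a_def)
  qed
  moreover have "onorm T \<le> 1 / c"
    using norm_T c by (intro onorm_bound) (auto simp: mult.commute)
  moreover have "T (v n) = e n" for n
  proof -
    have a_v: "a (v n) m = (if m = n then 1 else 0)" for m
      using v(1)[of n m] v_pos[of n] by (auto simp: a_def power2_norm_eq_inner)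
    then have "T (v n) = (\<Sum>m\<in>{n}. a (v n) m *\<^sub>R e m)"
      unfolding T_def by (intro suminf_finite) (auto simp: a_v)
    then show ?thesis by (simp add: a_v)
  qed
  ultimately show ?thesis by blast
qed

text \<open>Bessel's inequality gives convergence to 0 at each point. It is uniform on a finite
  \<open>\<epsilon>/2\<close>-net, and the functionals have norm at most 1.\<close>

lemma orthonormal_uniformly_null_on_compact:
  fixes f :: "nat \<Rightarrow> 'a::real_inner"
  assumes f: "\<And>m n. f m \<bullet> f n = (if m = n then 1 else 0)"
    and C: "compact C" and \<epsilon>: "\<epsilon> > 0"
  shows "\<exists>N. \<forall>k\<ge>N. \<forall>x\<in>C. \<bar>x \<bullet> f k\<bar> < \<epsilon>"
proof -
  have norm_f: "norm (f n) = 1" for n using f by (simp add: norm_eq_sqrt_inner)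
  have null: "(\<lambda>k. y \<bullet> f k) \<longlonglongrightarrow> 0" for y
  proof -
    have "(\<Sum>k\<in>I. (y \<bullet> f k)\<^sup>2) \<le> (norm y)\<^sup>2" if "finite I" for I
      using bessel_orthogonal[OF that, of f y] f by (simp add: norm_f)
    then have "summable (\<lambda>k. (y \<bullet> f k)\<^sup>2)"
      by (intro bounded_imp_summable[of _ "(norm y)\<^sup>2"]) auto
    then have "(\<lambda>k. sqrt ((y \<bullet> f k)\<^sup>2)) \<longlonglongrightarrow> sqrt 0"
      by (intro tendsto_real_sqrt summable_LIMSEQ_zero)
    then show ?thesis by (simp add: tendsto_rabs_zero_iff)
  qed
  obtain F where F: "finite F" "C \<subseteq> (\<Union>y\<in>F. ball y (\<epsilon>/2))"
    using C \<epsilon> unfolding compact_eq_totally_bounded by (meson half_gt_zero)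
  have "eventually (\<lambda>k. \<bar>y \<bullet> f k\<bar> < \<epsilon>/2) sequentially" for y
    using order_tendstoD(2)[OF tendsto_rabs_zero[OF null[of y]], of "\<epsilon>/2"] \<epsilon> by simp
  then have "eventually (\<lambda>k. \<forall>y\<in>F. \<bar>y \<bullet> f k\<bar> < \<epsilon>/2) sequentially"
    using F(1) by (simp add: eventually_ball_finite)
  then obtain N where N: "\<And>k y. k \<ge> N \<Longrightarrow> y \<in> F \<Longrightarrow> \<bar>y \<bullet> f k\<bar> < \<epsilon>/2"
    by (auto simp: eventually_sequentially)
  have "\<bar>x \<bullet> f k\<bar> < \<epsilon>" if k: "k \<ge> N" and x: "x \<in> C" for k x
  proof -
    obtain y where y: "y \<in> F" "dist y x < \<epsilon>/2" using F(2) x by auto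
    have "\<bar>(x - y) \<bullet> f k\<bar> \<le> norm (x - y)"
      using Cauchy_Schwarz_ineq2[of "x - y" "f k"] by (simp add: norm_f)
    then show ?thesis
      using N[OF k y(1)] y(2) by (simp add: dist_norm norm_minus_commute inner_diff_left)
  qed
  then show ?thesis by blast
qed

text \<open>A diagonal argument in place of Baire's theorem: the closed span of an orthonormal sequence
  is not covered by countably many compact sets. Membership of \<open>u\<close> in the closed span is
  expressed by the operators that vanish on the sequence.\<close>

lemma closed_span_avoids_compacts:
  fixes f :: "nat \<Rightarrow> 'a::hilbert_space"
  assumes f: "\<And>m n. f m \<bullet> f n = (if m = n then 1 else 0)" and C: "\<And>n :: nat. compact (C n)"
  obtains u where "u \<notin> (\<Union>n. C n)"
    "\<And>L :: 'a \<Rightarrow> 'a. bounded_linear L \<Longrightarrow> (\<And>n. L (f n) = 0) \<Longrightarrow> L u = 0"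
proof -
  have null: "\<exists>N. \<forall>k\<ge>N. \<forall>x\<in>C n. \<bar>x \<bullet> f k\<bar> < (1/2) ^ n" for n
    by (rule orthonormal_uniformly_null_on_compact[OF f C]) simp
  \<comment> \<open>At the index \<open>s n\<close> all points of \<open>C n\<close> have
    coefficient below \<open>(1/2) ^ n\<close>, while \<open>u\<close> will have exactly this
    coefficient there. Strict growth of \<open>s\<close> keeps the chosen vectors distinct.\<close>
  have "\<exists>s. \<forall>n. (\<forall>x\<in>C n. \<bar>x \<bullet> f (s n)\<bar> < (1/2) ^ n) \<and> s n < s (Suc n)"
  proof (rule dependent_nat_choice)
    show "\<exists>k. \<forall>x\<in>C 0. \<bar>x \<bullet> f k\<bar> < (1/2) ^ 0" using null[of 0] by blast
    fix k n
    obtain N where "\<forall>k\<ge>N. \<forall>x\<in>C (Suc n). \<bar>x \<bullet> f k\<bar> < (1/2) ^ Suc n" using null by blast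
    then show "\<exists>l. (\<forall>x\<in>C (Suc n). \<bar>x \<bullet> f l\<bar> < (1/2) ^ Suc n) \<and> k < l"
      by (intro exI[of _ "max N (Suc k)"]) auto
  qed
  then obtain s where s: "\<And>n x. x \<in> C n \<Longrightarrow> \<bar>x \<bullet> f (s n)\<bar> < (1/2) ^ n" "strict_mono s"
    by (auto simp: strict_mono_Suc_iff)
  define u where "u = (\<Sum>n. (1/2 :: real) ^ n *\<^sub>R f (s n))"
  have norm_f: "norm (f n) = 1" for n using f by (simp add: norm_eq_sqrt_inner)
  have sum: "summable (\<lambda>n. (1/2 :: real) ^ n *\<^sub>R f (s n))"
    by (rule summable_norm_cancel) (simp add: norm_f power_abs[symmetric] summable_geometric)
  have "u \<bullet> f (s m) = (1/2) ^ m" for m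
  proof -
    have "u \<bullet> f (s m) = (\<Sum>n. ((1/2 :: real) ^ n *\<^sub>R f (s n)) \<bullet> f (s m))"
      unfolding u_def by (rule bounded_linear.suminf[OF bounded_linear_inner_left sum])
    also have "\<dots> = (\<Sum>n\<in>{m}. ((1/2 :: real) ^ n *\<^sub>R f (s n)) \<bullet> f (s m))"
      using s(2) by (intro suminf_finite) (auto simp: f strict_mono_eq)
    finally show ?thesis by (simp add: f)
  qed
  then have "u \<notin> C n" for n using s(1)[of u n] by fastforce
  moreover have "L u = 0" if "bounded_linear L" "\<And>n. L (f n) = 0" for L :: "'a \<Rightarrow> 'a"
  proof -
    have "L u = (\<Sum>n. L ((1/2 :: real) ^ n *\<^sub>R f (s n)))"
      unfolding u_def by (rule bounded_linear.suminf[OF that(1) sum])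
    then show ?thesis using that(2) linear_scale[OF bounded_linear.linear[OF that(1)]] by simp
  qed
  ultimately show ?thesis using that by blast
qed

subsection \<open>Connected attractors\<close>

text \<open>Stated for real linear operators, so that it serves both scalar fields.\<close>

lemma connected_attractor_outside_compacts:
  fixes S T :: "'a::hilbert_space \<Rightarrow> 'a"
  assumes S: "bounded_linear S" "onorm S < 1" and T: "bounded_linear T" "onorm T < 1"
    and \<sigma>: "\<sigma> = 1 \<or> \<sigma> = -1"
    and f: "\<And>m n. f m \<bullet> f n = (if m = n then 1 else 0)"
    and Tf: "\<And>n :: nat. T (f n + \<sigma> *\<^sub>R S (f n)) = f n"
    and K: "\<And>n :: nat. compact (K n)"
  shows "\<exists>w. w \<notin> (\<Union>n. K n) \<and> connected (attractor {S, \<lambda>x. T x + w})"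
proof -
  interpret S: bounded_linear S by fact
  interpret T: bounded_linear T by fact
  obtain Q where Q: "\<And>w. Q w = S (Q w) + w"
    using bounded_linear_contraction_fixpoint[OF S] by metis
  obtain R where R: "continuous_on UNIV R" "\<And>w e. e = T e + w \<Longrightarrow> e = R w"
    using bounded_linear_contraction_fixpoint[OF T] by metis
  \<comment> \<open>\<open>P\<close> recovers \<open>u\<close> from the fixed point
    \<open>e\<close>. Hence it suffices that \<open>u\<close> avoids the compact sets
    \<open>P\<close> R \<open>K n\<close>.\<close>
  define P where "P e = (if \<sigma> = 1 then e - S e else e)" for e
  have "continuous_on (R ` K n) P" for n
    unfolding P_def using S.continuous_on[OF continuous_on_id]
    by (cases "\<sigma> = 1") (simp_all add: continuous_on_diff continuous_on_id)
  then have "compact (P ` R ` K n)" for n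
    using R(1) K by (meson compact_continuous_image continuous_on_subset subset_UNIV)
  then obtain u where u: "u \<notin> (\<Union>n. P ` R ` K n)"
    "\<And>L :: 'a \<Rightarrow> 'a. bounded_linear L \<Longrightarrow> (\<And>n. L (f n) = 0) \<Longrightarrow> L u = 0"
    using closed_span_avoids_compacts[OF f, of "\<lambda>n. P ` R ` K n"] by metis
  \<comment> \<open>This operator vanishes on every \<open>f n\<close>, so the identity
    \<open>Tf\<close> extends to \<open>u\<close>.\<close>
  have "bounded_linear (\<lambda>x. T (x + \<sigma> *\<^sub>R S x) - x)"
    using S(1) T(1) by (intro bounded_linear_sub bounded_linear_compose[OF T(1)] bounded_linear_add
        bounded_linear_const_scaleR bounded_linear_ident)
  then have Tu: "T (u + \<sigma> *\<^sub>R S u) = u" using u(2)[of "\<lambda>x. T (x + \<sigma> *\<^sub>R S x) - x"] Tf by simp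
  define e where "e = (if \<sigma> = 1 then Q u else u)"
  have Pe: "P e = u" using Q[of u] by (simp add: P_def e_def algebra_simps)
  define w where "w = e - T e"
  have "e = R w" by (rule R(2)) (simp add: w_def)
  then have w: "w \<notin> (\<Union>n. K n)" using u(1) Pe by blast
  define g where "g x = T x + w" for x
  \<comment> \<open>The \<open>1/2\<close> keeps the common ratio positive when both operators
    vanish.\<close>
  define c where "c = max (1/2) (max (onorm S) (onorm T))"
  have lip: "norm (L x - L y) \<le> c * norm (x - y)"
    if "bounded_linear L" "onorm L \<le> c" for L :: "'a \<Rightarrow> 'a" and x y
  proof -
    have "norm (L (x - y)) \<le> onorm L * norm (x - y)" by (rule onorm[OF that(1)])
    also have "\<dots> \<le> c * norm (x - y)" using that(2) by (rule mult_right_mono) simp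
    finally show ?thesis using linear_diff[OF bounded_linear.linear[OF that(1)]] by simp
  qed
  interpret contractive_pair S g c
    by unfold_locales
      (use S T lip in \<open>auto simp: c_def g_def dist_norm less_max_iff_disj le_max_iff_disj\<close>)
  \<comment> \<open>\<open>0\<close> is a fixed point of \<open>S\<close>, so the closure of its
    orbit is the attractor.\<close>
  define A where "A = closure (orbit 0)"
  have A: "invariant A" unfolding A_def by (rule invariant_closure_orbit) (rule S.zero)
  have eA: "e \<in> A" by (rule fixpoint_in_invariant[OF A]) (simp add: g_def w_def)
  have sub: "x \<in> A \<Longrightarrow> S x \<in> A" for x using A by (auto simp: invariant_def)
  have zeroA: "0 \<in> A" using closure_subset orbit.base unfolding A_def by blast
  have "S ` A \<inter> g ` A \<noteq> {}"
  proof (cases "\<sigma> = 1")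
    case True
    have ue: "u = e - S e" using Pe True by (simp add: P_def)
    then have "u + \<sigma> *\<^sub>R S u = e - S (S e)" using True by (simp add: S.diff)
    then have "T e - T (S (S e)) = e - S e" using Tu ue by (metis T.diff)
    then have "g (S (S e)) = S e" by (simp add: g_def w_def algebra_simps)
    then show ?thesis using eA sub by (metis Int_iff empty_iff imageI)
  next
    case False
    then have "T (e - S e) = e" using Tu \<sigma> by (auto simp: e_def)
    then have "g (S e) = S 0" by (simp add: g_def w_def T.diff S.zero algebra_simps)
    then show ?thesis using eA sub zeroA by (metis Int_iff empty_iff imageI)
  qed
  then have "connected A" by (rule connected_invariant[OF A])
  then have "connected (attractor {S, \<lambda>x. T x + w})"
    using attractor_eqI[OF A] by (simp add: g_def[abs_def])
  then show ?thesis using w by blast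
qed

subsection \<open>Complex scalars\<close>

text \<open>The sequence \<open>x 0, J (x 0), x 1, J (x 1), ...\<close>. With \<open>J\<close> the
  multiplication by \<i>, it makes a complex orthogonal sequence into a real orthogonal one.\<close>

definition interleave :: "('a \<Rightarrow> 'a) \<Rightarrow> (nat \<Rightarrow> 'a) \<Rightarrow> nat \<Rightarrow> 'a" where
  "interleave J x n = (if even n then x (n div 2) else J (x (n div 2)))"

text \<open>\<open>J\<close> is isometric and skew-adjoint. Skewness makes \<open>x k\<close>
  orthogonal to \<open>J (x k)\<close> and moves \<open>J\<close> from one factor to the
  other.\<close>

lemma interleave_orthogonal:
  fixes x :: "nat \<Rightarrow> 'a::real_inner"
  assumes J: "\<And>x y. J x \<bullet> J y = x \<bullet> y" "\<And>x y. x \<bullet> J y = - (J x \<bullet> y)"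
    and x: "\<And>k n. k < n \<Longrightarrow> x n \<bullet> x k = 0" "\<And>k n. k < n \<Longrightarrow> x n \<bullet> J (x k) = 0"
    and "m \<noteq> n"
  shows "interleave J x m \<bullet> interleave J x n = 0"
proof -
  have less: "x n \<bullet> x k = 0" "x n \<bullet> J (x k) = 0" "J (x n) \<bullet> x k = 0" "J (x n) \<bullet> J (x k) = 0"
    if "k < n" for k n
    using x[OF that] J(1)[of "x n" "x k"] J(2)[of "x n" "x k"] by auto
  have same: "x k \<bullet> J (x k) = 0" "J (x k) \<bullet> x k = 0" for k
    using J(2)[of "x k" "x k"] by (auto simp: inner_commute)
  consider "m div 2 < n div 2" | "n div 2 < m div 2" | "m div 2 = n div 2" by linarith
  then show ?thesis
  proof cases
    case 1
    then show ?thesis using less[OF 1] by (auto simp: interleave_def inner_commute)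
  next
    case 2
    then show ?thesis using less[OF 2] by (auto simp: interleave_def inner_commute)
  next
    case 3
    then have "even m \<noteq> even n" using \<open>m \<noteq> n\<close> by (metis even_two_times_div_two odd_two_times_div_two_succ)
    then show ?thesis using 3 same by (auto simp: interleave_def)
  qed
qed

text \<open>The two rules for \<i> are what \<open>interleave_orthogonal\<close> asks of
  \<open>J\<close>. Boundedness comes from computing the norm through \<open>cinner\<close>.\<close>

lemma bounded_linear_scaleC: "bounded_linear (scaleC c :: 'a::chilbert_space \<Rightarrow> 'a)"
  and inner_scaleC_ii: "scaleC \<i> x \<bullet> scaleC \<i> y = x \<bullet> (y :: 'a)"
  and inner_scaleC_ii_right: "x \<bullet> scaleC \<i> y = - (scaleC \<i> x \<bullet> (y :: 'a))"
  and scaleC_minus_one: "scaleC (- 1) x = - (x :: 'a)"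
proof -
  have right: "cinner x (scaleC c y) = cnj c * cinner x y" for c and x y :: 'a
    by (metis cinner_commute cinner_scaleC_left complex_cnj_mult)
  have "(norm (scaleC c x))\<^sup>2 = (norm x * cmod c)\<^sup>2" for x :: 'a
  proof -
    have "(norm (scaleC c x))\<^sup>2 = Re (c * (cnj c * cinner x x))"
      unfolding power2_norm_eq_inner inner_eq_Re_cinner by (simp only: cinner_scaleC_left right[of _ c x] mult.left_commute)
    also have "c * (cnj c * cinner x x) = complex_of_real ((cmod c)\<^sup>2) * cinner x x"
      by (simp only: complex_norm_square mult.assoc)
    also have "Re \<dots> = (cmod c)\<^sup>2 * (norm x)\<^sup>2"
      unfolding power2_norm_eq_inner[of x] inner_eq_Re_cinner
      using Re_complex_of_real Im_complex_of_real by (simp only: times_complex.sel)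
    finally show ?thesis by (simp add: power_mult_distrib mult.commute)
  qed
  then have "norm (scaleC c x) \<le> norm x * cmod c" for x :: 'a by simp
  moreover have "scaleC c (r *\<^sub>R x) = r *\<^sub>R scaleC c x" for r and x :: 'a
    by (metis mult.commute scaleC_of_real scaleC_scaleC)
  ultimately show "bounded_linear (scaleC c :: 'a \<Rightarrow> 'a)"
    by (intro bounded_linear_intro) (auto simp: scaleC_add_right)
  show "scaleC \<i> x \<bullet> scaleC \<i> y = x \<bullet> y" "x \<bullet> scaleC \<i> y = - (scaleC \<i> x \<bullet> y)"
    by (simp_all add: inner_eq_Re_cinner cinner_scaleC_left right)
  show "scaleC (- 1) x = - x" using scaleC_of_real[of "-1" x] by simp
qed

lemma bounded_clinearI:
  fixes T :: "'a::chilbert_space \<Rightarrow> 'a"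
  assumes T: "bounded_linear T" and ii: "\<And>x. T (scaleC \<i> x) = scaleC \<i> (T x)"
  shows "bounded_clinear T"
proof -
  interpret bounded_linear T by fact
  have split: "scaleC c x = Re c *\<^sub>R x + Im c *\<^sub>R scaleC \<i> x" for c and x :: 'a
  proof -
    have "c = complex_of_real (Re c) + complex_of_real (Im c) * \<i>"
      by (simp add: complex_eq_iff)
    then show ?thesis by (metis scaleC_add_left scaleC_of_real scaleC_scaleC)
  qed
  have "T (scaleC c x) = scaleC c (T x)" for c x
    by (simp only: split[of c x] split[of c "T x"] add scaleR ii)
  then show ?thesis using T by (simp add: bounded_clinear_def)
qed

text \<open>The complex linear operator is the average of the real one over the action of \<open>\<i>\<close>.\<close>

lemma orthogonal_system_clinear_operator:
  fixes e v :: "nat \<Rightarrow> 'a::chilbert_space"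
  assumes e: "\<And>n. norm (e n) = 1" "\<And>k n. k < n \<Longrightarrow> e n \<bullet> e k = 0"
      "\<And>k n. k < n \<Longrightarrow> e n \<bullet> scaleC \<i> (e k) = 0"
    and v: "\<And>n. norm (v n) \<ge> c" "\<And>k n. k < n \<Longrightarrow> v n \<bullet> v k = 0"
      "\<And>k n. k < n \<Longrightarrow> v n \<bullet> scaleC \<i> (v k) = 0"
    and c: "c > 0"
  shows "\<exists>T. bounded_clinear T \<and> onorm T \<le> 1 / c \<and> (\<forall>n. T (v n) = e n)"
proof -
  let ?J = "scaleC \<i> :: 'a \<Rightarrow> 'a"
  interpret J: bounded_linear ?J by (rule bounded_linear_scaleC)
  have JJ: "?J (?J x) = - x" for x by (simp add: scaleC_scaleC scaleC_minus_one)
  have norm_J: "norm (?J x) = norm x" for x by (simp add: norm_eq_sqrt_inner inner_scaleC_ii)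
  have orth_e: "interleave ?J e m \<bullet> interleave ?J e n = (if m = n then 1 else 0)" for m n
  proof (cases "m = n")
    case True
    have "norm (interleave ?J e n) = 1" by (simp add: interleave_def norm_J e(1))
    then show ?thesis using True by (simp add: norm_eq_1)
  next
    case False
    then show ?thesis
      using interleave_orthogonal[OF inner_scaleC_ii inner_scaleC_ii_right e(2,3) False] by simp
  qed
  have orth_v: "interleave ?J v m \<bullet> interleave ?J v n = 0" if "m \<noteq> n" for m n
    by (rule interleave_orthogonal[OF inner_scaleC_ii inner_scaleC_ii_right v(2,3) that])
  have norm_v: "norm (interleave ?J v n) \<ge> c" for n by (simp add: interleave_def norm_J v(1))
  have "\<exists>T. bounded_linear T \<and> onorm T \<le> 1 / c \<and>
      (\<forall>n. T (interleave ?J v n) = interleave ?J e n)"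
    by (rule orthogonal_system_operator[OF orth_e orth_v norm_v c])
  then obtain T where T: "bounded_linear T" "onorm T \<le> 1 / c"
    "\<And>n. T (interleave ?J v n) = interleave ?J e n"
    by auto
  interpret T: bounded_linear T by fact
  have Tv: "T (v n) = e n" "T (?J (v n)) = ?J (e n)" for n
    using T(3)[of "2 * n"] T(3)[of "Suc (2 * n)"] by (simp_all add: interleave_def)
  \<comment> \<open>As \<open>?J\<close> squares to -1, the conjugate of \<open>T\<close> by
    \<open>?J\<close> is \<open>x \<mapsto> - ?J (T (?J x))\<close>, and its average with
    \<open>T\<close> commutes with \<open>?J\<close>. The value at \<open>v n\<close> survives
    because \<open>T\<close> also sends \<open>?J (v n)\<close> to \<open>?J (e n)\<close>.\<close>
  define U where "U x = (1/2) *\<^sub>R (T x - ?J (T (?J x)))" for x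
  have "bounded_linear U"
    unfolding U_def
    by (intro bounded_linear_const_scaleR bounded_linear_sub T(1)
        bounded_linear_compose[OF J.bounded_linear_axioms] bounded_linear_compose[OF T(1)]
        J.bounded_linear_axioms)
  moreover have "U (?J x) = ?J (U x)" for x
    by (simp add: U_def JJ T.neg J.neg J.scaleR J.diff algebra_simps)
  ultimately have "bounded_clinear U" by (rule bounded_clinearI)
  moreover have "onorm U \<le> 1 / c"
  proof (rule onorm_bound)
    show "0 \<le> 1 / c" using c by simp
    fix x
    have nT: "norm (T y) \<le> 1 / c * norm y" for y
      using onorm[OF T(1), of y] mult_right_mono[OF T(2) norm_ge_zero[of y]] by linarith
    have "norm (T x - ?J (T (?J x))) \<le> norm (T x) + norm (T (?J x))"
      using norm_triangle_ineq4[of "T x" "?J (T (?J x))"] by (simp add: norm_J)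
    also have "\<dots> \<le> 2 * (1 / c * norm x)"
      using nT[of x] nT[of "?J x"] by (simp add: norm_J)
    finally show "norm (U x) \<le> 1 / c * norm x" by (simp add: U_def mult.commute)
  qed
  moreover have "U (v n) = e n" for n
    by (simp add: U_def Tv JJ flip: scaleR_2)
  ultimately show ?thesis by blast
qed

section \<open>Compactness of \<open>S\<close> over the real and over the complex scalars\<close>

lemma compact_operator_if_attractors_disconnected:
  fixes S :: "'a::hilbert_space \<Rightarrow> 'a"
  assumes S: "bounded_linear S" "onorm S < 1"
    and disc: "\<And>T :: 'a \<Rightarrow> 'a. bounded_linear T \<Longrightarrow> onorm T < 1 \<Longrightarrow>
      \<exists>K :: nat \<Rightarrow> 'a set. (\<forall>n. compact (K n)) \<and>
        (\<forall>w. w \<notin> (\<Union>n. K n) \<longrightarrow> \<not> connected (attractor {S, \<lambda>x. T x + w}))"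
  shows "compact_operator S"
proof (rule ccontr)
  assume nc: "\<not> compact_operator S"
  have fin: "finite {id :: 'a \<Rightarrow> 'a}" by simp
  show False
  proof (rule noncompact_operator_orthogonal_sequence[OF S(1) nc fin])
    fix f :: "nat \<Rightarrow> 'a" and \<delta> \<sigma> :: real
    assume \<delta>: "\<delta> > 0" and \<sigma>: "\<sigma> = 1 \<or> \<sigma> = -1" and f1: "\<And>n. norm (f n) = 1"
      and v1: "\<And>n. norm (f n + \<sigma> *\<^sub>R S (f n)) ^ 2 \<ge> 1 + \<delta>"
      and f2: "\<And>k n g. k < n \<Longrightarrow> g \<in> {id} \<Longrightarrow> f n \<bullet> g (f k) = 0"
      and v2: "\<And>k n g. k < n \<Longrightarrow> g \<in> {id} \<Longrightarrow>
        (f n + \<sigma> *\<^sub>R S (f n)) \<bullet> g (f k + \<sigma> *\<^sub>R S (f k)) = 0"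
    define v where "v n = f n + \<sigma> *\<^sub>R S (f n)" for n
    have ff: "f m \<bullet> f n = (if m = n then 1 else 0)" for m n
      using f1[of m] f2[of m n id] f2[of n m id]
      by (cases m n rule: linorder_cases) (auto simp: norm_eq_1 inner_commute)
    have vv: "v m \<bullet> v n = 0" if "m \<noteq> n" for m n
      using v2[of m n id] v2[of n m id] that
      by (cases m n rule: linorder_cases) (auto simp: v_def inner_commute)
    \<comment> \<open>The lower bound exceeds 1, which makes the operator \<open>T\<close> sending
      \<open>v n\<close> to \<open>f n\<close> a contraction, hence admissible in
      \<open>disc\<close>.\<close>
    have norm_v: "norm (v n) \<ge> sqrt (1 + \<delta>)" for n
      using v1[of n] by (simp add: v_def real_le_lsqrt)
    have pos: "sqrt (1 + \<delta>) > 0" using \<delta> by simp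
    have "\<exists>T. bounded_linear T \<and> onorm T \<le> 1 / sqrt (1 + \<delta>) \<and> (\<forall>n. T (v n) = f n)"
      by (rule orthogonal_system_operator[OF ff vv norm_v pos])
    then obtain T where T: "bounded_linear T" "onorm T \<le> 1 / sqrt (1 + \<delta>)" "\<And>n. T (v n) = f n"
      by auto
    have "1 / sqrt (1 + \<delta>) < 1" using \<delta> by simp
    then have T1: "onorm T < 1" using T(2) by linarith
    obtain K :: "nat \<Rightarrow> 'a set" where K: "\<And>n. compact (K n)"
      "\<And>w. w \<notin> (\<Union>n. K n) \<Longrightarrow> \<not> connected (attractor {S, \<lambda>x. T x + w})"
      using disc[OF T(1) T1] by blast
    have "\<exists>w. w \<notin> (\<Union>n. K n) \<and> connected (attractor {S, \<lambda>x. T x + w})"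
      by (rule connected_attractor_outside_compacts[OF S T(1) T1 \<sigma> ff T(3)[unfolded v_def] K(1)])
    then show False using K(2) by metis
  qed
qed

lemma compact_operator_if_attractors_disconnected_complex:
  fixes S :: "'a::chilbert_space \<Rightarrow> 'a"
  assumes S: "bounded_clinear S" "onorm S < 1"
    and disc: "\<And>T :: 'a \<Rightarrow> 'a. bounded_clinear T \<Longrightarrow> onorm T < 1 \<Longrightarrow>
      \<exists>K :: nat \<Rightarrow> 'a set. (\<forall>n. compact (K n)) \<and>
        (\<forall>w. w \<notin> (\<Union>n. K n) \<longrightarrow> \<not> connected (attractor {S, \<lambda>x. T x + w}))"
  shows "compact_operator S"
proof (rule ccontr)
  assume nc: "\<not> compact_operator S"
  have lin: "bounded_linear S" using S(1) by (simp add: bounded_clinear_def)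
  have fin: "finite {id, scaleC \<i> :: 'a \<Rightarrow> 'a}" by simp
  show False
  proof (rule noncompact_operator_orthogonal_sequence[OF lin nc fin])
    fix f :: "nat \<Rightarrow> 'a" and \<delta> \<sigma> :: real
    assume \<delta>: "\<delta> > 0" and \<sigma>: "\<sigma> = 1 \<or> \<sigma> = -1" and f1: "\<And>n. norm (f n) = 1"
      and v1: "\<And>n. norm (f n + \<sigma> *\<^sub>R S (f n)) ^ 2 \<ge> 1 + \<delta>"
      and f2: "\<And>k n g. k < n \<Longrightarrow> g \<in> {id, scaleC \<i>} \<Longrightarrow> f n \<bullet> g (f k) = 0"
      and v2: "\<And>k n g. k < n \<Longrightarrow> g \<in> {id, scaleC \<i>} \<Longrightarrow>
        (f n + \<sigma> *\<^sub>R S (f n)) \<bullet> g (f k + \<sigma> *\<^sub>R S (f k)) = 0"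
    define v where "v n = f n + \<sigma> *\<^sub>R S (f n)" for n
    have f': "f n \<bullet> f k = 0" "f n \<bullet> scaleC \<i> (f k) = 0" if "k < n" for k n
      using f2[OF that, of id] f2[OF that, of "scaleC \<i>"] by simp_all
    have v': "v n \<bullet> v k = 0" "v n \<bullet> scaleC \<i> (v k) = 0" if "k < n" for k n
      using v2[OF that, of id] v2[OF that, of "scaleC \<i>"] by (simp_all add: v_def)
    have ff: "f m \<bullet> f n = (if m = n then 1 else 0)" for m n
      using f1[of m] f'(1)[of m n] f'(1)[of n m]
      by (cases m n rule: linorder_cases) (auto simp: norm_eq_1 inner_commute)
    have norm_v: "norm (v n) \<ge> sqrt (1 + \<delta>)" for n
      using v1[of n] by (simp add: v_def real_le_lsqrt)
    have pos: "sqrt (1 + \<delta>) > 0" using \<delta> by simp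
    \<comment> \<open>The hypothesis covers complex linear \<open>T\<close> only, hence the use of
      the averaged operator.\<close>
    have "\<exists>T. bounded_clinear T \<and> onorm T \<le> 1 / sqrt (1 + \<delta>) \<and> (\<forall>n. T (v n) = f n)"
      by (rule orthogonal_system_clinear_operator[OF f1 f' norm_v v' pos])
    then obtain T where T: "bounded_clinear T" "onorm T \<le> 1 / sqrt (1 + \<delta>)" "\<And>n. T (v n) = f n"
      by auto
    have "1 / sqrt (1 + \<delta>) < 1" using \<delta> by simp
    then have T1: "onorm T < 1" using T(2) by linarith
    have lin_T: "bounded_linear T" using T(1) by (simp add: bounded_clinear_def)
    obtain K :: "nat \<Rightarrow> 'a set" where K: "\<And>n. compact (K n)"
      "\<And>w. w \<notin> (\<Union>n. K n) \<Longrightarrow> \<not> connected (attractor {S, \<lambda>x. T x + w})"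
      using disc[OF T(1) T1] by blast
    have "\<exists>w. w \<notin> (\<Union>n. K n) \<and> connected (attractor {S, \<lambda>x. T x + w})"
      by (rule connected_attractor_outside_compacts[OF lin S(2) lin_T T1 \<sigma> ff T(3)[unfolded v_def] K(1)])
    then show False using K(2) by metis
  qed
qed

theorem theorem3p1:
  fixes S :: "'a::hilbert_space \<Rightarrow> 'a"
    and S' :: "'b::chilbert_space \<Rightarrow> 'b"
  shows
    "(infinite_dimensional (scaleR :: real \<Rightarrow> 'a \<Rightarrow> 'a) \<longrightarrow>
      bounded_linear S \<longrightarrow> onorm S < 1 \<longrightarrow>
      (\<forall>T :: 'a \<Rightarrow> 'a. bounded_linear T \<longrightarrow> onorm T < 1 \<longrightarrow>
        (\<exists>K :: nat \<Rightarrow> 'a set. (\<forall>n. compact (K n)) \<and>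
          (\<forall>w. w \<notin> (\<Union>n. K n) \<longrightarrow>
            \<not> connected (attractor {\<lambda>x. S x, \<lambda>x. T x + w})))) \<longrightarrow>
      compact_operator S)
   \<and>
     (infinite_dimensional (scaleC :: complex \<Rightarrow> 'b \<Rightarrow> 'b) \<longrightarrow>
      bounded_clinear S' \<longrightarrow> onorm S' < 1 \<longrightarrow>
      (\<forall>T :: 'b \<Rightarrow> 'b. bounded_clinear T \<longrightarrow> onorm T < 1 \<longrightarrow>
        (\<exists>K :: nat \<Rightarrow> 'b set. (\<forall>n. compact (K n)) \<and>
          (\<forall>w. w \<notin> (\<Union>n. K n) \<longrightarrow>
            \<not> connected (attractor {\<lambda>x. S' x, \<lambda>x. T x + w})))) \<longrightarrow>
      compact_operator S')"
  using compact_operator_if_attractors_disconnected[of S]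
    compact_operator_if_attractors_disconnected_complex[of S'] by simp

end
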